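(* Let $m,k,r$ be positive integers with $r\le k\le m$, let $d$ be a positive divisor of $m$, and let $A_d(m,k)\subset\mathbb{Z}_m$ be the $k$-element set defined below. Let $v$ and $w$ be the positive remainders of $k$ and $r$ modulo $d$, respectively (i.e. $v,w\in\{1,\ldots,d\}$ with $v\equiv k$, $w\equiv r \pmod d$). Then for every integer $h>r$, \[ |h^{(\geq r)}A_d(m,k)| = \begin{cases} \min\left\{m,\ \left(h\left\lceil \frac{k}{d}\right\rceil-h+1\right)d,\ h(k-1)-r(r-1)+1\right\} & \text{if } r\le\min\{v,d-1\},\\ \min\{m,\ h(k-1)-r(r-1)+1-\delta_d\} & \text{otherwise},\end{cases} \] where \[ \delta_d = \begin{cases} (h-r)(v-1)+w(v-w)-(d-1) & \text{if } w<v,\\ (h-r)(v-1)+(d-w)(w-v)-(d-1) & \text{if } v<w<d,\\ (h-r)(v-1)-(d-1) & \text{otherwise}.\end{cases} \]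
   Context: $\mathbb{Z}_m=\{0,1,\ldots,m-1\}$ with addition modulo $m$. For a positive divisor $d$ of $m$, let $H=\{0, m/d, 2m/d,\ldots,(d-1)m/d\}$ be the subgroup of $\mathbb{Z}_m$ of order $d$. Write $k=ud+v$ with integers $u\ge0$ and $1\le v\le d$, and define \[ A_d(m,k) := \bigcup_{i=0}^{u-1}(i+H)\ \cup\ \left\{u+j\cdot\tfrac{m}{d} : j=0,1,\ldots,v-1\right\}, \] a $k$-element subset of $\mathbb{Z}_m$. For a finite non-empty set $A=\{a_1,\ldots,a_k\}$ in an abelian group, a positive integer $r\le k$ and an integer $h\ge r$, define $h^{(\geq r)}A := \{ \sum_{i\in I} x_i a_i : I\subset\{1,\ldots,k\},\ |I|\ge r,\ x_i\ge 1 \text{ for all } i\in I,\ \sum_{i\in I}x_i = h\}$, i.e. the set of sums of $h$ elements of $A$ among which at least $r$ are distinct.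
   Formalization: When v = w, δ_d is replaced by max{0, δ_d} in the "otherwise" case; the printed formula fails there, e.g. for m=4, d=2, k=r=3, h=4 it gives 4 while the set {0,1,3} has 3 elements. *)

theory Defs
  imports "HOL-Algebra.Algebra" "HOL-Number_Theory.Cong"
begin

text \<open>
  The group \<open>\<int>\<^sub>m\<close> is \<^term>\<open>integer_mod_group m\<close>, whose carrier is \<open>{0..<int m}\<close> for \<open>m > 0\<close>.
  HOL-Algebra writes groups multiplicatively: below, \<open>a [^]\<^bsub>G\<^esub> n\<close> is the multiple \<open>n a\<close>
  and \<^const>\<open>finprod\<close> is the sum over the index set.
\<close>

text \<open>
  The set \<open>h\<^sup>(\<^sup>\<ge>\<^sup>r\<^sup>) A\<close>. Since \<open>a\<^sub>1, \<dots>, a\<^sub>k\<close> enumerates \<open>A\<close> without repetition, the index set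
  \<open>I\<close> is taken as a subset of \<open>A\<close> itself.
\<close>

definition sumset_ge :: "('a, 'b) monoid_scheme \<Rightarrow> nat \<Rightarrow> nat \<Rightarrow> 'a set \<Rightarrow> 'a set" where
  "sumset_ge G h r A =
     {finprod G (\<lambda>a. a [^]\<^bsub>G\<^esub> x a) I | (I :: 'a set) (x :: 'a \<Rightarrow> nat).
        I \<subseteq> A \<and> r \<le> card I \<and> (\<forall>a\<in>I. 1 \<le> x a) \<and> (\<Sum>a\<in>I. x a) = h}"

definition subgroup_H :: "nat \<Rightarrow> nat \<Rightarrow> int set" where
  "subgroup_H m d = {int (j * (m div d)) | j. j < d}"

definition A_d :: "nat \<Rightarrow> nat \<Rightarrow> nat \<Rightarrow> int set" where
  "A_d d m k =
     (let u = (k - 1) div d; v = k - u * d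
      in (\<Union>i<u. int i <#\<^bsub>integer_mod_group m\<^esub> subgroup_H m d)
         \<union> {int (u + j * (m div d)) | j. j < v})"

text \<open>
  The values of \<open>u\<close> and \<open>v\<close> in \<^const>\<open>A_d\<close> are those given by \<open>k = u d + v\<close> with \<open>1 \<le> v \<le> d\<close>.
\<close>

lemma A_d_eq:
  assumes "k = u * d + v" "1 \<le> v" "v \<le> d"
  shows "A_d d m k =
     (\<Union>i<u. int i <#\<^bsub>integer_mod_group m\<^esub> subgroup_H m d)
     \<union> {int (u + j * (m div d)) | j. j < v}"
proof -
  have "(k - 1) div d = u"
  proof -
    have "k - 1 = u * d + (v - 1)" "v - 1 < d" using assms by auto
    then show ?thesis by (metis add.commute add_cancel_right_right div_less div_mult_self1 less_nat_zero_code)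
  qed
  then show ?thesis using assms by (simp add: A_d_def Let_def)
qed

text \<open>
  Where the last case comes from \<open>v = w < d\<close>, the value of \<open>\<delta>\<^sub>d\<close> may be negative, and then
  \<open>min {m, h (k - 1) - r (r - 1) + 1 - \<delta>\<^sub>d}\<close> with \<open>r > v\<close> can exceed the size of the sumset:
  for \<open>m = 4\<close>, \<open>d = 2\<close>, \<open>k = r = 3\<close>, \<open>h = 4\<close> it is \<open>4\<close>, but \<open>4\<^sup>(\<^sup>\<ge>\<^sup>3\<^sup>) {0,1,2} = {0,1,3}\<close> in
  \<open>\<int>\<^sub>4\<close>. The theorem therefore replaces \<open>\<delta>\<^sub>d\<close> by \<open>max 0 \<delta>\<^sub>d\<close> when \<open>v = w\<close>.
\<close>

definition delta_d :: "nat \<Rightarrow> nat \<Rightarrow> nat \<Rightarrow> nat \<Rightarrow> nat \<Rightarrow> int" where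
  "delta_d d h r v w =
     (if w < v then
        (int h - int r) * (int v - 1) + int w * (int v - int w) - (int d - 1)
      else if v < w \<and> w < d then
        (int h - int r) * (int v - 1) + (int d - int w) * (int w - int v) - (int d - 1)
      else (int h - int r) * (int v - 1) - (int d - 1))"

end

theory Submission
  imports Defs
begin

text \<open>
  Write \<open>m = n d\<close>. Then \<open>A\<^sub>d(m,k)\<close> consists of the residues \<open>i + j n\<close> where \<open>x = i d + j\<close>
  (\<open>j < d\<close>) runs over \<open>0, \<dots>, k - 1\<close>; call \<open>i\<close> the level of the element. Since at least \<open>r\<close>
  summands are distinct, a sum of the required kind is a sum of \<open>r\<close> distinct elements plus \<open>h - r\<close>
  arbitrary ones. The total levels that occur form an interval. For every total level below the
  maximal one, a free summand can be moved through a complete coset of \<open>H\<close>, so the whole coset is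
  attained. At the maximal level the free summands only range over the incomplete coset, and the
  attained elements of the coset are counted separately, according to whether the \<open>r\<close> distinct
  summands of maximal level are all in the last coset, are uniquely determined, or leave
  another coset partially used. Counting modulo \<open>m\<close> caps the number of levels at \<open>n\<close>.
\<close>

section \<open>Sums over subsets of an interval of indices\<close>

text \<open>Induction on \<open>k\<close>: if \<open>t\<close> is at most the largest
  \<open>r\<close>-subset sum below \<open>k\<close>, the induction hypothesis applies unchanged.
  Otherwise the index \<open>k\<close> is put into \<open>R\<close>, and \<open>t - g k\<close> has
  to be reached with one index fewer; steps of size at most 1 keep it in range.\<close>

lemma subset_sum_interpolation:
  fixes g :: "nat \<Rightarrow> nat"
  assumes mono: "mono g" and step: "\<And>i. g (Suc i) \<le> Suc (g i)"
  shows "\<lbrakk>r \<le> k; sum g {..<r} \<le> t; t \<le> sum g {k - r..<k}\<rbrakk>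
    \<Longrightarrow> \<exists>R\<subseteq>{..<k}. card R = r \<and> sum g R = t"
proof (induction k arbitrary: r t)
  case 0
  then show ?case by auto
next
  case (Suc k)
  show ?case
  proof (cases "r = 0 \<or> r = Suc k")
    case True
    then show ?thesis
    proof
      assume "r = 0" then show ?thesis using Suc.prems by (intro exI[of _ "{}"]) auto
    next
      assume "r = Suc k"
      then show ?thesis using Suc.prems
        by (intro exI[of _ "{..<r}"]) (auto simp: lessThan_atLeast0)
    qed
  next
    case False
    then obtain q where q: "r = Suc q" "q < k" using Suc.prems(1) by (cases r) auto
    show ?thesis
    proof (cases "t \<le> sum g {k - r..<k}")
      case True
      then obtain R where "R \<subseteq> {..<k}" "card R = r" "sum g R = t"
        using Suc.IH[of r t] Suc.prems q by auto
      then show ?thesis by (intro exI[of _ R]) auto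
    next
      case False
      have "sum g {..<q} \<le> sum g {k - r..<k - 1}"
      proof -
        have "sum g {k - r..<k - 1} = (\<Sum>i<q. g (i + (k - r)))"
          using q by (subst sum.atLeastLessThan_shift_0) (auto simp: lessThan_atLeast0 add.commute)
        also have "\<dots> \<ge> sum g {..<q}"
          by (intro sum_mono monoD[OF mono]) auto
        finally show ?thesis .
      qed
      moreover have "sum g {k - r..<k} = sum g {k - r..<k - 1} + g (k - 1)"
        using q by (cases k) auto
      moreover have "g k \<le> Suc (g (k - 1))" using step[of "k - 1"] q by simp
      \<comment> \<open>The excess of \<open>t\<close> over the largest sum below \<open>k\<close>
        is at least 1, which pays for the possible step from \<open>g (k - 1)\<close> to
        \<open>g k\<close>.\<close>
      ultimately have lo: "g k + sum g {..<q} \<le> t" using False by linarith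
      have "sum g {Suc k - r..<Suc k} = sum g {k - q..<k} + g k"
        using q by simp
      then have "\<exists>R\<subseteq>{..<k}. card R = q \<and> sum g R = t - g k"
        using Suc.prems(3) lo q by (intro Suc.IH) auto
      then obtain R where R: "R \<subseteq> {..<k}" "card R = q" "sum g R = t - g k" by blast
      have "finite R" "k \<notin> R" using R(1) finite_subset by auto
      then show ?thesis using R q lo
        by (intro exI[of _ "insert k R"]) auto
    qed
  qed
qed

lemma card_Diff_commute:
  assumes "finite A" "finite B" "card A = card B"
  shows "card (A - B) = card (B - A)"
  using assms by (simp add: card_Diff_subset_Int inf_commute)

text \<open>The common part cancels, and \<open>A - B\<close> and \<open>B - A\<close> have equally
  many elements, so a constant \<open>c\<close> separating the values of \<open>g\<close> on the two
  differences compares the sums.\<close>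

lemma sum_exchange:
  fixes g :: "'a \<Rightarrow> nat"
  assumes fin: "finite A" "finite B" and card: "card A = card B"
    and ge: "\<And>x. x \<in> B - A \<Longrightarrow> c \<le> g x"
  shows sum_exchange_le: "(\<And>x. x \<in> A - B \<Longrightarrow> g x \<le> c) \<Longrightarrow> sum g A \<le> sum g B"
    and sum_exchange_less: "A \<noteq> B \<Longrightarrow> (\<And>x. x \<in> A - B \<Longrightarrow> g x < c) \<Longrightarrow> sum g A < sum g B"
proof -
  have B: "card (A - B) * c \<le> sum g (B - A)"
    using sum_bounded_below[of "B - A" c g] ge card_Diff_commute[OF fin card] by simp
  have split: "sum g A = sum g (A \<inter> B) + sum g (A - B)" "sum g B = sum g (A \<inter> B) + sum g (B - A)"
    using sum.Int_Diff[OF fin(1), of g B] sum.Int_Diff[OF fin(2), of g A] by (simp_all add: inf_commute)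
  show "sum g A \<le> sum g B" if "\<And>x. x \<in> A - B \<Longrightarrow> g x \<le> c"
    using sum_bounded_above[of "A - B" g c] that B split by fastforce
  show "sum g A < sum g B" if "A \<noteq> B" and less: "\<And>x. x \<in> A - B \<Longrightarrow> g x < c"
  proof -
    have "A - B \<noteq> {}"
      using \<open>A \<noteq> B\<close> fin card card_subset_eq[of B A] by auto
    then have "sum g (A - B) < card (A - B) * c"
      using fin sum_strict_mono[of "A - B" g "\<lambda>_. c"] less by simp
    then show ?thesis using B split by linarith
  qed
qed

lemma sum_le_sum_final:
  fixes g :: "nat \<Rightarrow> nat"
  assumes "mono g" "R \<subseteq> {..<k}" "card R = r"
  shows "sum g R \<le> sum g {k - r..<k}"
proof -
  have "finite R" "r \<le> k" using assms(2,3) finite_subset card_mono[of "{..<k}" R] by auto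
  then show ?thesis using assms
    by (intro sum_exchange_le[where c = "g (k - r)"]) (auto intro!: monoD[OF assms(1)])
qed

text \<open>The jump of \<open>g\<close> at \<open>k - r\<close> makes every exchange against the
  final segment strict, so the maximum has a unique maximizer.\<close>

lemma sum_eq_sum_final_imp_eq:
  fixes g :: "nat \<Rightarrow> nat"
  assumes "mono g" "R \<subseteq> {..<k}" "card R = r" "sum g R = sum g {k - r..<k}"
    and jump: "\<And>i. i < k - r \<Longrightarrow> g i < g (k - r)"
  shows "R = {k - r..<k}"
proof (rule ccontr)
  assume neq: "R \<noteq> {k - r..<k}"
  have "finite R" "r \<le> k" using assms(2,3) finite_subset card_mono[of "{..<k}" R] by auto
  moreover have "card R = card {k - r..<k}" using \<open>r \<le> k\<close> assms(3) by simp
  moreover have "x < k - r" if "x \<in> R - {k - r..<k}" for x using that assms(2) by auto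
  ultimately have "sum g R < sum g {k - r..<k}" using neq
    by (intro sum_exchange_less[where c = "g (k - r)"] jump) (auto intro!: monoD[OF assms(1)])
  then show False using assms(4) by simp
qed

lemma sum_initial_le_sum:
  fixes g :: "nat \<Rightarrow> nat"
  assumes "mono g" "finite R" "card R = r"
  shows "sum g {..<r} \<le> sum g R"
  using assms by (intro sum_exchange_le[where c = "g r"]) (auto intro!: monoD[OF assms(1)])

lemma ex_list_sum_list:
  fixes N :: nat
  shows "t \<le> s * N \<Longrightarrow> \<exists>xs. length xs = s \<and> set xs \<subseteq> {..N} \<and> sum_list xs = t"
proof (induction s arbitrary: t)
  case (Suc s)
  then have "t - min t N \<le> s * N" by auto
  from Suc.IH[OF this] obtain xs where "length xs = s" "set xs \<subseteq> {..N}" "sum_list xs = t - min t N"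
    by blast
  then show ?case by (intro exI[of _ "min t N # xs"]) auto
qed auto

lemma card_image_mod_atLeastAtMost:
  fixes a b d :: nat
  assumes "0 < d" "a \<le> b"
  shows "card ((\<lambda>x. x mod d) ` {a..b}) = min d (b - a + 1)"
proof (cases "b - a + 1 \<le> d")
  case True
  have "inj_on (\<lambda>x. x mod d) {a..b}"
  proof (rule inj_onI)
    have *: "i = j" if "i \<in> {a..b}" "j \<in> {a..b}" "i mod d = j mod d" "i \<le> j" for i j
    proof -
      have "d dvd j - i" using that by (metis mod_eq_dvd_iff_nat)
      moreover have "j - i < d" using that(1,2) True by auto
      ultimately show ?thesis using that(4) by (metis dvd_imp_le diff_is_0_eq le_antisym not_less zero_less_iff_neq_zero)
    qed
    fix i j assume "i \<in> {a..b}" "j \<in> {a..b}" "i mod d = j mod d"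
    then show "i = j" using *[of i j] *[of j i] by (cases "i \<le> j") auto
  qed
  then show ?thesis using True assms by (simp add: card_image)
next
  case False
  have "(\<lambda>x. x mod d) ` {a..b} = {..<d}"
  proof (intro equalityI subsetI)
    fix j assume "j \<in> {..<d}"
    \<comment> \<open>The least number \<open>>= a\<close> congruent to \<open>j\<close>; adding
      \<open>d * a\<close> keeps the natural subtraction from truncating.\<close>
    define x where "x = a + (j + d * a - a) mod d"
    have "a \<le> d * a" using assms(1) by simp
    then have "a + (j + d * a - a) = j + d * a" by linarith
    moreover have "x mod d = (a + (j + d * a - a)) mod d" by (simp add: x_def mod_add_right_eq)
    ultimately have "x mod d = (j + d * a) mod d" by simp
    also have "\<dots> = j" using \<open>j \<in> _\<close> by simp
    finally have "x mod d = j" .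
    moreover have "x \<in> {a..b}"
      using False mod_less_divisor[OF assms(1), of "j + d * a - a"] unfolding x_def atLeastAtMost_iff by linarith
    ultimately show "j \<in> (\<lambda>x. x mod d) ` {a..b}" by blast
  qed (use assms in auto)
  then show ?thesis using False by simp
qed

section \<open>The sumset as a set of residues\<close>

lemma finprod_integer_mod_group:
  assumes "finite I" "f \<in> I \<rightarrow> carrier (integer_mod_group m)"
  shows "finprod (integer_mod_group m) f I = (\<Sum>i\<in>I. f i) mod int m"
proof -
  interpret comm_group "integer_mod_group m" by simp
  show ?thesis using assms
  proof (induction I rule: finite_induct)
    case (insert i I)
    then show ?case by (subst finprod_insert) (auto simp: mod_add_right_eq)
  qed simp
qed

lemma sum_list_eq_sum_count:
  fixes xs :: "int list"
  assumes "finite S" "set xs \<subseteq> S"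
  shows "sum_list xs = (\<Sum>a\<in>S. int (count_list xs a) * a)"
  using assms(2)
proof (induction xs)
  case (Cons b xs)
  have "(\<Sum>a\<in>S. int (count_list (b # xs) a) * a)
      = (\<Sum>a\<in>S. int (count_list xs a) * a + (if a = b then a else 0))"
    by (intro sum.cong) (auto simp: algebra_simps)
  with Cons assms(1) show ?case by (simp add: sum.distrib)
qed simp

lemma ex_list_with_counts:
  fixes y :: "int \<Rightarrow> nat"
  assumes "finite I"
  shows "\<exists>xs. set xs \<subseteq> I \<and> length xs = (\<Sum>a\<in>I. y a) \<and> sum_list xs = (\<Sum>a\<in>I. int (y a) * a)"
  using assms
proof (induction I rule: finite_induct)
  case (insert a I)
  then obtain xs where "set xs \<subseteq> I" "length xs = (\<Sum>a\<in>I. y a)" "sum_list xs = (\<Sum>a\<in>I. int (y a) * a)"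
    by blast
  with insert show ?case
    by (intro exI[of _ "replicate (y a) a @ xs"]) (auto simp: sum_list_replicate)
qed auto

text \<open>Removing one copy of each element of some \<open>r\<close>-subset of the support leaves
  a multiset of \<open>h - r\<close> summands, here written as a list. Conversely, adding those
  copies back gives a support of at least \<open>r\<close> elements.\<close>

lemma sumset_ge_integer_mod_group:
  assumes A: "A \<subseteq> carrier (integer_mod_group m)" "finite A" and rh: "r \<le> h"
  shows "sumset_ge (integer_mod_group m) h r A =
    {(\<Sum>R + sum_list xs) mod int m | R xs.
       R \<subseteq> A \<and> card R = r \<and> length xs = h - r \<and> set xs \<subseteq> A}" (is "?L = ?S")
proof -
  have prod: "finprod (integer_mod_group m) (\<lambda>a. a [^]\<^bsub>integer_mod_group m\<^esub> x a) I
      = (\<Sum>a\<in>I. int (x a) * a) mod int m" if "I \<subseteq> A" for I and x :: "int \<Rightarrow> nat"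
    using that A finite_subset[OF that A(2)]
    by (subst finprod_integer_mod_group) (auto simp: carrier_integer_mod_group mod_sum_eq)
  show ?thesis
  proof (intro equalityI subsetI)
    fix z assume "z \<in> ?L"
    then obtain I x where I: "I \<subseteq> A" "r \<le> card I" and x: "\<forall>a\<in>I. 1 \<le> x a" "(\<Sum>a\<in>I. x a) = h"
      and z: "z = (\<Sum>a\<in>I. int (x a) * a) mod int m"
      unfolding sumset_ge_def using prod by auto
    have fin: "finite I" using I A finite_subset by auto
    obtain R where R: "R \<subseteq> I" "card R = r" using obtain_subset_with_card_n[OF I(2)] by metis
    define y where "y a = x a - of_bool (a \<in> R)" for a
    have xy: "x a = y a + of_bool (a \<in> R)" if "a \<in> I" for a
      using x(1) that by (auto simp: y_def)
    obtain xs where xs: "set xs \<subseteq> I" "length xs = (\<Sum>a\<in>I. y a)"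
      "sum_list xs = (\<Sum>a\<in>I. int (y a) * a)"
      using ex_list_with_counts[OF fin, of y] by blast
    have RI: "I \<inter> R = R" using R by blast
    have "h = (\<Sum>a\<in>I. y a) + r"
      using x(2) xy R fin RI by (simp add: sum.distrib of_bool_def sum.If_cases)
    moreover have "(\<Sum>a\<in>I. int (x a) * a) = \<Sum>R + (\<Sum>a\<in>I. int (y a) * a)"
    proof -
      have "(\<Sum>a\<in>I. int (x a) * a) = (\<Sum>a\<in>I. int (y a) * a + (if a \<in> R then a else 0))"
        by (intro sum.cong) (auto simp: xy algebra_simps)
      then show ?thesis using fin RI by (simp add: sum.distrib sum.If_cases)
    qed
    ultimately show "z \<in> ?S" using z xs R I by (auto intro!: exI[of _ R] exI[of _ xs])
  next
    fix z assume "z \<in> ?S"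
    then obtain R xs where R: "R \<subseteq> A" "card R = r" and xs: "length xs = h - r" "set xs \<subseteq> A"
      and z: "z = (\<Sum>R + sum_list xs) mod int m" by blast
    define I where "I = R \<union> set xs"
    define x where "x a = of_bool (a \<in> R) + count_list xs a" for a
    have fin: "finite I" "I \<subseteq> A" using R xs A finite_subset unfolding I_def by auto
    have RI: "I \<inter> R = R" unfolding I_def by blast
    have "(\<Sum>a\<in>I. x a) = r + (\<Sum>a\<in>I. count_list xs a)"
      using fin RI R by (simp add: x_def sum.distrib of_bool_def sum.If_cases)
    also have "(\<Sum>a\<in>I. count_list xs a) = h - r"
      using sum_count_set[of xs I] fin xs by (simp add: I_def)
    finally have "(\<Sum>a\<in>I. x a) = h" using rh by simp
    moreover have "(\<Sum>a\<in>I. int (x a) * a) = \<Sum>R + sum_list xs"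
    proof -
      have "(\<Sum>a\<in>I. int (x a) * a) = (\<Sum>a\<in>I. (if a \<in> R then a else 0) + int (count_list xs a) * a)"
        by (intro sum.cong) (auto simp: x_def algebra_simps)
      moreover have "sum_list xs = (\<Sum>a\<in>I. int (count_list xs a) * a)"
        using sum_list_eq_sum_count[OF fin(1), of xs] by (simp add: I_def)
      ultimately show ?thesis using fin RI by (simp add: sum.distrib sum.If_cases)
    qed
    moreover have "\<forall>a\<in>I. 1 \<le> x a"
      using count_list_0_iff[of xs] by (auto simp: I_def x_def Suc_le_eq)
    moreover have "r \<le> card I" using R card_mono[OF fin(1), of R] by (auto simp: I_def)
    moreover have "z = finprod (integer_mod_group m) (\<lambda>a. a [^]\<^bsub>integer_mod_group m\<^esub> x a) I"
      unfolding prod[OF fin(2)] z by (simp add: \<open>(\<Sum>a\<in>I. int (x a) * a) = \<Sum>R + sum_list xs\<close>)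
    ultimately show "z \<in> ?L" using fin(2)
      unfolding sumset_ge_def by blast
  qed
qed

text \<open>The quotient of the index \<open>x\<close> by \<open>d\<close> selects the coset and the
  remainder selects the element in it; the last \<open>v\<close> indices give the incomplete
  coset.\<close>

lemma A_d_eq_image:
  assumes "0 < d" "0 < k" "k \<le> n * d"
  shows "A_d d (n * d) k = (\<lambda>x. int (x div d + x mod d * n)) ` {..<k}"
proof -
  define u v where "u = (k - 1) div d" and "v = k - u * d"
  have "k - 1 = u * d + (k - 1) mod d" "(k - 1) mod d < d" using assms by (auto simp: u_def)
  then have k: "k = u * d + v" "1 \<le> v" "v \<le> d" using assms unfolding v_def by linarith+
  have "u < n"
  proof (rule ccontr)
    assume "\<not> u < n"
    then have "n * d \<le> u * d" by simp
    then show False using k assms by linarith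
  qed
  \<comment> \<open>Because \<open>i < u < n\<close>, the representatives \<open>i + j * n\<close>
    stay below \<open>n * d\<close>, so the group addition does not wrap around.\<close>
  have coset: "int i <#\<^bsub>integer_mod_group (n * d)\<^esub> subgroup_H (n * d) d = (\<lambda>j. int (i + j * n)) ` {..<d}"
    if "i < u" for i
  proof -
    have "i + j * n < n * d" if "j < d" for j
    proof -
      have "j * n + n \<le> d * n" using that by (metis Suc_leI add.commute mult_Suc mult_le_mono1)
      then show ?thesis using \<open>i < u\<close> \<open>u < n\<close> by (simp add: mult.commute)
    qed
    then have "(int i + int (j * n)) mod int (n * d) = int (i + j * n)" if "j < d" for j
      using that by (metis mod_less of_nat_add of_nat_mod)
    then show ?thesis using assms(1) unfolding l_coset_def subgroup_H_def by auto
  qed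
  have "A_d d (n * d) k = (\<Union>i<u. (\<lambda>j. int (i + j * n)) ` {..<d}) \<union> (\<lambda>j. int (u + j * n)) ` {..<v}"
    unfolding A_d_eq[OF k] using coset assms(1) by auto
  also have "\<dots> = (\<lambda>x. int (x div d + x mod d * n)) ` {..<k}" (is "?L = ?S")
  proof (intro equalityI subsetI)
    fix z assume "z \<in> ?L"
    then consider i j where "i < u" "j < d" "z = int (i + j * n)" | j where "j < v" "z = int (u + j * n)"
      by blast
    then show "z \<in> ?S"
    proof cases
      case 1
      then have "i * d + d \<le> u * d" by (metis Suc_leI add.commute mult_Suc mult_le_mono1)
      then show ?thesis using 1 k by (intro image_eqI[of _ _ "i * d + j"]) auto
    next
      case 2
      then show ?thesis using k by (intro image_eqI[of _ _ "u * d + j"]) auto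
    qed
  next
    fix z assume "z \<in> ?S"
    then obtain x where x: "x < k" "z = int (x div d + x mod d * n)" by blast
    show "z \<in> ?L"
    proof (cases "x < u * d")
      case True
      then have "x div d < u" using assms(1) by (simp add: div_less_iff_less_mult)
      moreover have "z \<in> (\<lambda>j. int (x div d + j * n)) ` {..<d}" using x(2) assms(1) by auto
      ultimately show ?thesis by blast
    next
      case False
      define y where "y = x - u * d"
      have y: "x = u * d + y" "y < v" using False x k unfolding y_def by linarith+
      then show ?thesis using x k by auto
    qed
  qed
  finally show ?thesis .
qed

section \<open>Levels and residues\<close>

text \<open>A residue modulo \<open>n * d\<close> determines the level \<open>i\<close> only modulo
  \<open>n\<close>. With at least \<open>n\<close> complete levels everything is covered; with
  fewer, the levels \<open>lo..hi\<close> are distinct modulo \<open>n\<close> and the encoding is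
  injective.\<close>

lemma card_image_two_digit_mod:
  fixes n d lo hi :: nat
  assumes "0 < n" "0 < d" "lo \<le> hi" "P \<subseteq> {..<d}" "P \<noteq> {}"
  shows "card ((\<lambda>(i, j). (i + j * n) mod (n * d)) ` ({lo..<hi} \<times> {..<d} \<union> {hi} \<times> P))
    = min (n * d) ((hi - lo) * d + card P)" (is "card (?f ` ?E) = _")
proof (cases "n \<le> hi - lo")
  case True
  have "?f ` ?E = {..<n * d}"
  proof (intro equalityI subsetI)
    fix z assume "z \<in> {..<n * d}"
    \<comment> \<open>The least level \<open>>= lo\<close> congruent to \<open>z\<close> modulo
      \<open>n\<close>. It lies below \<open>hi\<close> because at least \<open>n\<close> levels are
      complete.\<close>
    define i where "i = lo + (z + n * lo - lo) mod n"
    have i: "i \<in> {lo..<hi}"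
      using True mod_less_divisor[OF assms(1), of "z + n * lo - lo"] assms(3)
      unfolding i_def atLeastLessThan_iff by linarith
    have "lo \<le> n * lo" using assms(1) by simp
    then have "lo + (z + n * lo - lo) = z + n * lo" by linarith
    moreover have "i mod n = (lo + (z + n * lo - lo)) mod n" by (simp add: i_def mod_add_right_eq)
    ultimately have imod: "i mod n = z mod n" by simp
    \<comment> \<open>Adding the multiple \<open>n * d * i\<close> of the modulus to
      \<open>z\<close> makes the subtraction of \<open>i\<close> genuine.\<close>
    have "i \<le> n * d * i" using assms(1,2) by simp
    then have le: "i \<le> z + n * d * i" by linarith
    have "n dvd (z + n * d * i) - i"
      using imod le by (metis mod_eq_dvd_iff_nat mod_mult_self2 mult.assoc)
    then obtain q where q: "(z + n * d * i) - i = n * q" by blast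
    have "?f (i, q mod d) = z"
    proof -
      have "(q mod d * n) mod (n * d) = (q * n) mod (n * d)"
        by (metis mod_mod_trivial mult.commute mult_mod_right)
      then have "(i + q mod d * n) mod (n * d) = (i + q * n) mod (n * d)" by (metis mod_add_right_eq)
      also have "i + q * n = z + n * d * i" using q le by (simp add: mult.commute)
      finally show ?thesis using \<open>z \<in> _\<close> by simp
    qed
    moreover have "q mod d < d" using assms(2) by simp
    ultimately show "z \<in> ?f ` ?E" using i by (intro image_eqI[of _ _ "(i, q mod d)"]) auto
  qed (use assms in auto)
  moreover have "n * d \<le> (hi - lo) * d" using True by (rule mult_le_mono1)
  then have "min (n * d) ((hi - lo) * d + card P) = n * d" by linarith
  ultimately show ?thesis by (simp only: card_lessThan)
next
  case False
  \<comment> \<open>Injectivity is shown on the full rectangle: reduction modulo \<open>n\<close>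
    recovers the level, and cancelling it recovers \<open>j\<close> modulo \<open>d\<close>.\<close>
  have "inj_on ?f ({lo..hi} \<times> {..<d})"
  proof (rule inj_onI, clarsimp)
    fix i j i' j'
    assume *: "lo \<le> i" "i \<le> hi" "lo \<le> i'" "i' \<le> hi" "j < d" "j' < d"
      and eq: "(i + j * n) mod (n * d) = (i' + j' * n) mod (n * d)"
    have "(i + j * n) mod n = (i' + j' * n) mod n"
      using eq by (metis mod_mod_cancel dvd_triv_left)
    then have imod: "i mod n = i' mod n" by simp
    have aux: "a = b" if "a \<le> b" "a mod n = b mod n" "lo \<le> a" "b \<le> hi" for a b
    proof -
      have "n dvd b - a" using that by (metis mod_eq_dvd_iff_nat)
      moreover have "b - a < n" using that False by linarith
      ultimately show ?thesis using that(1) by (metis dvd_imp_le diff_is_0_eq le_antisym not_less zero_less_iff_neq_zero)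
    qed
    have i: "i = i'" using aux[of i i'] aux[of i' i] imod * by (cases "i \<le> i'") auto
    have "[j * n = j' * n] (mod (n * d))"
      using eq unfolding i cong_def[symmetric] by (simp add: cong_add_lcancel_nat)
    then have "[j = j'] (mod d)"
      using assms(1) by (simp add: cong_def mult.commute[of _ n] flip: mult_mod_right)
    then show "i = i' \<and> j = j'" using i * by (simp add: cong_def)
  qed
  then have "inj_on ?f ?E" by (rule inj_on_subset) (use assms in auto)
  then have "card (?f ` ?E) = card ?E" by (rule card_image)
  also have "\<dots> = (hi - lo) * d + card P"
    using assms finite_subset[OF assms(4)] by (subst card_Un_disjoint) (auto simp: card_cartesian_product)
  finally have card: "card (?f ` ?E) = (hi - lo) * d + card P" .
  have "(hi - lo) * d + d \<le> n * d" using False by (metis Suc_leI add.commute mult_Suc mult_le_mono1 not_less)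
  moreover have "card P \<le> d" using card_mono[OF _ assms(4)] by simp
  ultimately show ?thesis using card by linarith
qed

text \<open>The residue is reduced modulo \<open>d\<close> because \<open>j * n\<close> matters only
  modulo \<open>n * d\<close>. The total level stays unreduced, so that a maximal level makes
  sense.\<close>

definition level_pairs :: "nat \<Rightarrow> nat \<Rightarrow> nat \<Rightarrow> nat \<Rightarrow> (nat \<times> nat) set" where
  "level_pairs d k r s =
    {((\<Sum>x\<in>R. x div d) + (\<Sum>x\<leftarrow>xs. x div d), ((\<Sum>x\<in>R. x mod d) + (\<Sum>x\<leftarrow>xs. x mod d)) mod d) | R xs.
       R \<subseteq> {..<k} \<and> card R = r \<and> length xs = s \<and> set xs \<subseteq> {..<k}}"

lemma mono_div: "mono (\<lambda>x::nat. x div d)"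
  by (simp add: mono_def div_le_mono)

lemma Suc_div_le: "Suc i div d \<le> Suc (i div d)"
  by (metis div_Suc le_SucI order_refl)

text \<open>These sums are not reduced modulo \<open>d\<close>: as natural numbers they can form
  intervals, to which the residues of the free summands are then added.\<close>

definition top_residues :: "nat \<Rightarrow> nat \<Rightarrow> nat \<Rightarrow> nat set" where
  "top_residues d k r =
    {\<Sum>x\<in>R. x mod d | R. R \<subseteq> {..<k} \<and> card R = r \<and> (\<Sum>x\<in>R. x div d) = (\<Sum>x=k-r..<k. x div d)}"

lemma sum_list_le_length:
  fixes f :: "'a \<Rightarrow> nat"
  assumes "\<And>x. x \<in> set xs \<Longrightarrow> f x \<le> u"
  shows "(\<Sum>x\<leftarrow>xs. f x) \<le> length xs * u"
  using assms by (induction xs) (auto intro: add_mono)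

lemma sum_list_eq_length:
  fixes f :: "'a \<Rightarrow> nat"
  assumes "\<And>x. x \<in> set xs \<Longrightarrow> f x \<le> u" "(\<Sum>x\<leftarrow>xs. f x) = length xs * u" "x \<in> set xs"
  shows "f x = u"
  using assms
proof (induction xs)
  case (Cons a xs)
  have "(\<Sum>x\<leftarrow>xs. f x) \<le> length xs * u" using Cons.prems by (intro sum_list_le_length) auto
  then have "f a = u" "(\<Sum>x\<leftarrow>xs. f x) = length xs * u"
    using Cons.prems(1)[of a] Cons.prems(2) by auto
  with Cons show ?case by auto
qed simp

text \<open>Below \<open>hi\<close> one free summand can be kept at a level under \<open>u\<close>,
  where all \<open>d\<close> residues are available. At \<open>hi\<close> every free summand has
  level \<open>u\<close> and residue at most \<open>v - 1\<close>, and \<open>R\<close> has the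
  greatest possible total level.\<close>

lemma level_pairs_eq:
  assumes "0 < d" "r \<le> k" "0 < s" and k: "k = u * d + v" "1 \<le> v" "v \<le> d"
  defines "lo \<equiv> \<Sum>x<r. x div d" and "hi \<equiv> (\<Sum>x=k-r..<k. x div d) + s * u"
  shows "level_pairs d k r s = {lo..<hi} \<times> {..<d} \<union>
    {hi} \<times> (\<lambda>x. x mod d) ` {t + e | t e. t \<in> top_residues d k r \<and> e \<le> s * (v - 1)}"
    (is "?L = ?A \<union> ?B")
proof (intro equalityI subsetI)
  have level: "x div d \<le> u" if "x < k" for x
  proof -
    have "x < Suc u * d" using that k by simp
    then show ?thesis using assms(1) by (metis div_less_iff_less_mult less_Suc_eq_le)
  qed
  fix p assume "p \<in> ?L"
  then obtain R xs where R: "R \<subseteq> {..<k}" "card R = r" and xs: "length xs = s" "set xs \<subseteq> {..<k}"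
    and p: "p = ((\<Sum>x\<in>R. x div d) + (\<Sum>x\<leftarrow>xs. x div d),
      ((\<Sum>x\<in>R. x mod d) + (\<Sum>x\<leftarrow>xs. x mod d)) mod d)"
    unfolding level_pairs_def by blast
  have fin: "finite R" using R finite_subset by auto
  have 1: "(\<Sum>x<r. x div d) \<le> (\<Sum>x\<in>R. x div d)" "(\<Sum>x\<in>R. x div d) \<le> (\<Sum>x=k-r..<k. x div d)"
    using sum_initial_le_sum[OF mono_div fin R(2)] sum_le_sum_final[OF mono_div R] by auto
  have 2: "(\<Sum>x\<leftarrow>xs. x div d) \<le> s * u"
    using sum_list_le_length[of xs "\<lambda>x. x div d" u] xs level by auto
  show "p \<in> ?A \<union> ?B"
  proof (cases "fst p = hi")
    case False
    then show ?thesis using 1 2 assms(1) unfolding p lo_def hi_def by auto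
  next
    case True
    \<comment> \<open>Both parts are bounded by their maxima, so a total of \<open>hi\<close> forces
      equality in each.\<close>
    then have eq: "(\<Sum>x\<in>R. x div d) = (\<Sum>x=k-r..<k. x div d)" "(\<Sum>x\<leftarrow>xs. x div d) = length xs * u"
      using 1 2 xs unfolding p hi_def by auto
    have "x mod d \<le> v - 1" if "x \<in> set xs" for x
    proof -
      have "x div d = u" using sum_list_eq_length[OF _ eq(2) that] level xs(2) by auto
      then have "x = u * d + x mod d" by (metis div_mult_mod_eq)
      moreover have "x < k" using that xs by auto
      ultimately show ?thesis using k by linarith
    qed
    then have "(\<Sum>x\<leftarrow>xs. x mod d) \<le> s * (v - 1)"
      using sum_list_le_length[of xs "\<lambda>x. x mod d" "v - 1"] xs by auto
    moreover have "(\<Sum>x\<in>R. x mod d) \<in> top_residues d k r" using eq R unfolding top_residues_def by blast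
    ultimately show ?thesis using True unfolding p by auto
  qed
next
  fix p assume "p \<in> ?A \<union> ?B"
  then show "p \<in> ?L"
  proof
    assume "p \<in> ?A"
    then obtain I j where p: "p = (I, j)" "lo \<le> I" "I < hi" "j < d" by auto
    define top where "top = (\<Sum>x=k-r..<k. x div d)"
    have lt: "lo \<le> top"
      using sum_initial_le_sum[OF mono_div, of "{k-r..<k}" r d] assms(2) unfolding lo_def top_def by simp
    have su: "s * u = (s - 1) * u + u" using assms(3) by (cases s) auto
    have hi: "hi = top + (s - 1) * u + u" unfolding hi_def top_def using su by simp
    \<comment> \<open>The level \<open>I\<close> is distributed greedily: first to the distinct
      summands, then to \<open>s - 1\<close> free ones, and the rest \<open>t2\<close> to the last
      free summand.\<close>
    define t where "t = min I top"
    define t1 where "t1 = min (I - t) ((s - 1) * u)"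
    define t2 where "t2 = I - t - t1"
    have t: "lo \<le> t" "t \<le> top" "t1 \<le> (s - 1) * u" "t + t1 + t2 = I"
      using p lt unfolding t_def t1_def t2_def by auto
    have t2: "t2 < u \<or> I < top + (s - 1) * u \<and> t2 = 0"
      using p hi unfolding t_def t1_def t2_def by linarith
    \<comment> \<open>Only \<open>u = 0\<close> could fail; then all levels vanish,
      \<open>hi\<close> is 0, and there is no \<open>I < hi\<close>.\<close>
    have "t2 < u"
    proof (rule ccontr)
      assume "\<not> t2 < u"
      then have "u = 0" using t2 by auto
      then have "top = 0" using k unfolding top_def by (intro sum.neutral) auto
      then show False using p hi \<open>u = 0\<close> by simp
    qed
    obtain R where R: "R \<subseteq> {..<k}" "card R = r" "(\<Sum>x\<in>R. x div d) = t"
      using subset_sum_interpolation[OF mono_div Suc_div_le assms(2), of d t] t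
      unfolding lo_def top_def by blast
    obtain ys where ys: "length ys = s - 1" "set ys \<subseteq> {..u}" "sum_list ys = t1"
      using ex_list_sum_list[OF t(3)] by blast
    have sum_ys: "(\<Sum>x\<leftarrow>map (\<lambda>y. y * d) ys. x div d) = t1"
      using ys(3) assms(1) by (simp add: o_def)
    define c where "c = (\<Sum>x\<in>R. x mod d) + (\<Sum>x\<leftarrow>map (\<lambda>y. y * d) ys. x mod d)"
    \<comment> \<open>The residue of the last free summand, chosen to correct the residue
      \<open>c\<close> of all the others to \<open>j\<close>; \<open>d * c\<close> again prevents
      truncation.\<close>
    define e where "e = (j + d * c - c) mod d"
    have "c \<le> d * c" using assms(1) by simp
    then have "c + (j + d * c - c) = j + d * c" by linarith
    moreover have "(c + e) mod d = (c + (j + d * c - c)) mod d" by (simp add: e_def mod_add_right_eq)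
    ultimately have ce: "(c + e) mod d = j" using p by simp
    have ed: "e < d" using assms(1) by (simp add: e_def)
    have in_k: "y * d < k" if "y \<le> u" for y
      using mult_le_mono1[OF that, of d] k by linarith
    have "t2 * d + d \<le> u * d" using \<open>t2 < u\<close> by (metis Suc_leI add.commute mult_Suc mult_le_mono1)
    then have "t2 * d + e < k" using ed k by linarith
    then have "set ((t2 * d + e) # map (\<lambda>y. y * d) ys) \<subseteq> {..<k}" using ys in_k by auto
    moreover have "length ((t2 * d + e) # map (\<lambda>y. y * d) ys) = s" using ys assms(3) by simp
    moreover have "p = ((\<Sum>x\<in>R. x div d) + (\<Sum>x\<leftarrow>(t2 * d + e) # map (\<lambda>y. y * d) ys. x div d),
      ((\<Sum>x\<in>R. x mod d) + (\<Sum>x\<leftarrow>(t2 * d + e) # map (\<lambda>y. y * d) ys. x mod d)) mod d)"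
    proof -
      have "(\<Sum>x\<in>R. x mod d) + (\<Sum>x\<leftarrow>(t2 * d + e) # map (\<lambda>y. y * d) ys. x mod d) = c + e"
        using ed by (simp add: c_def)
      moreover have "(\<Sum>x\<in>R. x div d) + (\<Sum>x\<leftarrow>(t2 * d + e) # map (\<lambda>y. y * d) ys. x div d) = I"
        using sum_ys R(3) t(4) ed assms(1) by (simp del: map_map)
      ultimately show ?thesis using p ce by simp
    qed
    ultimately show "p \<in> ?L" using R unfolding level_pairs_def by blast
  next
    assume "p \<in> ?B"
    then obtain t e where te: "t \<in> top_residues d k r" "e \<le> s * (v - 1)" and p: "p = (hi, (t + e) mod d)"
      by auto
    obtain R where R: "R \<subseteq> {..<k}" "card R = r"
      "(\<Sum>x\<in>R. x div d) = (\<Sum>x=k-r..<k. x div d)" "(\<Sum>x\<in>R. x mod d) = t"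
      using te(1) unfolding top_residues_def by blast
    obtain ys where ys: "length ys = s" "set ys \<subseteq> {..v - 1}" "sum_list ys = e"
      using ex_list_sum_list[OF te(2)] by blast
    have ysd: "y < d" "y < v" if "y \<in> set ys" for y using ys(2) that k by fastforce+
    have "(\<Sum>y\<leftarrow>ys. (u * d + y) div d) = (\<Sum>y\<leftarrow>ys. u)"
      using ysd assms(1) by (intro arg_cong[where f = sum_list] map_cong) auto
    then have 1: "(\<Sum>x\<leftarrow>map (\<lambda>y. u * d + y) ys. x div d) = s * u"
      using ys(1) by (simp add: o_def sum_list_triv)
    have "(\<Sum>y\<leftarrow>ys. (u * d + y) mod d) = (\<Sum>y\<leftarrow>ys. y)"
      using ysd by (intro arg_cong[where f = sum_list] map_cong) auto
    then have 2: "(\<Sum>x\<leftarrow>map (\<lambda>y. u * d + y) ys. x mod d) = e"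
      using ys(3) by (simp add: o_def)
    have "p = ((\<Sum>x\<in>R. x div d) + (\<Sum>x\<leftarrow>map (\<lambda>y. u * d + y) ys. x div d),
      ((\<Sum>x\<in>R. x mod d) + (\<Sum>x\<leftarrow>map (\<lambda>y. u * d + y) ys. x mod d)) mod d)"
      unfolding 1 2 R p hi_def by simp
    moreover have "length (map (\<lambda>y. u * d + y) ys) = s" "set (map (\<lambda>y. u * d + y) ys) \<subseteq> {..<k}"
      using ys(1) ysd k by auto
    ultimately show "p \<in> ?L" using R unfolding level_pairs_def by blast
  qed
qed

section \<open>Residue sums at the maximal level\<close>

lemma sum_shift_by:
  fixes f :: "nat \<Rightarrow> nat"
  shows "(\<Sum>x=c..<c + w. f x) = (\<Sum>i<w. f (c + i))"
  using sum.shift_bounds_nat_ivl[of f 0 c w] by (simp add: lessThan_atLeast0 add.commute)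

lemma sum_final_ident:
  assumes "w \<le> (v::nat)"
  shows "\<Sum>{v - w..<v} = \<Sum>{..<w} + w * (v - w)"
proof -
  have "\<Sum>{v - w..<v} = (\<Sum>i<w. (v - w) + i)"
    using assms sum_shift_by[of "\<lambda>x. x" "v - w" w] by (simp only: le_add_diff_inverse2)
  also have "\<dots> = (\<Sum>i<w. v - w) + \<Sum>{..<w}" by (rule sum.distrib)
  finally show ?thesis by simp
qed

lemma mono_ident: "mono (\<lambda>x::nat. x)"
  by (simp add: mono_def)

lemma sum_block_div_mod:
  assumes "R \<subseteq> {..<d}" "finite R"
  shows "(\<Sum>x\<in>(+) (l * d) ` R. x div d) = card R * l"
    and "(\<Sum>x\<in>(+) (l * d) ` R. x mod d) = \<Sum>R"
proof -
  have "(\<Sum>x\<in>(+) (l * d) ` R. x div d) = (\<Sum>x\<in>R. (l * d + x) div d)"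
    by (subst sum.reindex) auto
  also have "\<dots> = (\<Sum>x\<in>R. l)" using assms(1) by (intro sum.cong) auto
  finally have "(\<Sum>x\<in>(+) (l * d) ` R. x div d) = (\<Sum>x\<in>R. l)" .
  then show "(\<Sum>x\<in>(+) (l * d) ` R. x div d) = card R * l" by simp
  show "(\<Sum>x\<in>(+) (l * d) ` R. x mod d) = \<Sum>R"
    using assms(1) by (subst sum.reindex) (auto intro!: sum.cong)
qed

text \<open>For \<open>r <= v\<close> the maximum \<open>r * u\<close> is reached only inside the
  last, possibly incomplete block. The residues are then an arbitrary \<open>r\<close>-subset of
  \<open>{..<v}\<close>, and interpolation fills the interval between the extreme sums.\<close>

lemma top_residues_within_level:
  assumes k: "k = u * d + v" "v \<le> d" and "r \<le> v"
  shows "top_residues d k r = {\<Sum>{..<r}..\<Sum>{..<r} + r * (v - r)}"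
proof -
  have d: "x mod d = x - u * d" "x div d = u" if "x \<in> {u * d..<k}" for x
  proof -
    define y where "y = x - u * d"
    have "x = u * d + y" "y < d" using that k unfolding y_def atLeastLessThan_iff by linarith+
    then show "x mod d = x - u * d" "x div d = u" by auto
  qed
  have "{k - r..<k} \<subseteq> {u * d..<k}" using k assms(3) by auto
  then have "(\<Sum>x=k-r..<k. x div d) = (\<Sum>x=k-r..<k. u)" using d(2) by (intro sum.cong) auto
  then have top: "(\<Sum>x=k-r..<k. x div d) = r * u" using k assms(3) by simp
  show ?thesis
  proof (intro equalityI subsetI)
    fix t assume "t \<in> top_residues d k r"
    then obtain R where R: "R \<subseteq> {..<k}" "card R = r" "(\<Sum>x\<in>R. x div d) = r * u" "t = (\<Sum>x\<in>R. x mod d)"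
      unfolding top_residues_def top by blast
    have fin: "finite R" using R finite_subset by auto
    have le: "x div d \<le> u" if "x < k" for x
      using that d(2)[of x] by (cases "x < u * d") (auto simp: less_mult_imp_div_less less_imp_le)
    have "x div d = u" if "x \<in> R" for x
    proof (rule ccontr)
      assume "x div d \<noteq> u"
      then have "(\<Sum>x\<in>R. x div d) < (\<Sum>x\<in>R. u)"
        using R le that fin by (intro sum_strict_mono_ex1) (auto intro!: bexI[of _ x] simp: order_less_le)
      then show False using R by simp
    qed
    then have "u * d \<le> x" if "x \<in> R" for x using that div_times_less_eq_dividend[of x d] by simp
    then have sub: "R \<subseteq> {u * d..<k}" using R(1) by auto
    define R' where "R' = (\<lambda>x. x - u * d) ` R"
    have inj: "inj_on (\<lambda>x. x - u * d) R" using sub by (intro inj_on_diff_nat) auto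
    have "t = \<Sum>R'"
      unfolding R(4) R'_def sum.reindex[OF inj] using sub d(1) by (intro sum.cong) auto
    moreover have "x - u * d < v" if "x \<in> R" for x
      using subsetD[OF sub that] k unfolding atLeastLessThan_iff by linarith
    then have "R' \<subseteq> {..<v}" by (auto simp: R'_def)
    moreover have "card R' = r" using inj R by (simp add: R'_def card_image)
    moreover have "finite R'" using fin by (simp add: R'_def)
    ultimately show "t \<in> {\<Sum>{..<r}..\<Sum>{..<r} + r * (v - r)}"
      using sum_initial_le_sum[OF mono_ident, of R' r] sum_le_sum_final[OF mono_ident, of R' v r]
        sum_final_ident[OF assms(3)] unfolding atLeastAtMost_iff by simp
  next
    fix t assume "t \<in> {\<Sum>{..<r}..\<Sum>{..<r} + r * (v - r)}"
    then obtain R where R: "R \<subseteq> {..<v}" "card R = r" "\<Sum>R = t"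
      using subset_sum_interpolation[OF mono_ident _ assms(3), of t] sum_final_ident[OF assms(3)]
      unfolding atLeastAtMost_iff by auto
    have "finite R" "R \<subseteq> {..<d}" using R(1) k(2) finite_subset[OF R(1)] by auto
    then have "(\<Sum>x\<in>(+) (u * d) ` R. x div d) = r * u" "(\<Sum>x\<in>(+) (u * d) ` R. x mod d) = t"
      using sum_block_div_mod R by auto
    moreover have "(+) (u * d) ` R \<subseteq> {..<k}" using R(1) k(1) by auto
    moreover have "card ((+) (u * d) ` R) = r" using R by (simp add: card_image)
    ultimately show "t \<in> top_residues d k r" unfolding top_residues_def top
      by (intro CollectI exI[of _ "(+) (u * d) ` R"]) auto
  qed
qed

text \<open>A new level starts exactly at \<open>k - r\<close>, so the final segment is the only
  choice of maximal level.\<close>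

lemma top_residues_full_levels:
  assumes "d dvd k - r" "0 < d" "r \<le> k"
  shows "top_residues d k r = {\<Sum>x=k-r..<k. x mod d}"
proof -
  have "i div d < (k - r) div d" if "i < k - r" for i
    using that assms by (metis div_less_iff_less_mult dvd_div_mult_self)
  then have "R \<subseteq> {..<k} \<and> card R = r \<and> (\<Sum>x\<in>R. x div d) = (\<Sum>x=k-r..<k. x div d) \<longleftrightarrow> R = {k - r..<k}" for R
    using sum_eq_sum_final_imp_eq[OF mono_div, of R k r d] assms(3) by auto
  then show ?thesis unfolding top_residues_def by simp
qed

text \<open>The cut \<open>k - r\<close> falls strictly inside the complete block of level
  \<open>l\<close>. All later indices are taken, but any \<open>d - e\<close> indices of this block
  may be used, and their residue sums fill an interval with at least \<open>d\<close>
  elements.\<close>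

lemma top_residues_split_level:
  assumes "k - r = l * d + e" "0 < e" "e < d" "(l + 1) * d \<le> k" "r \<le> k"
  shows "\<exists>a. {a..a + (d - 1)} \<subseteq> top_residues d k r"
proof -
  define c where "c = (l + 1) * d"
  define a where "a = \<Sum>{..<d - e} + (\<Sum>x=c..<k. x mod d)"
  have c: "c = (k - r) + (d - e)" "c \<le> k" using assms unfolding c_def by auto
  have block: "{k - r..<c} = (+) (l * d) ` {e..<d}"
    using c assms(1,3) by auto
  have "(\<Sum>x=k-r..<c. x div d) = card {e..<d} * l"
    unfolding block by (rule sum_block_div_mod) auto
  then have top: "(\<Sum>x=k-r..<k. x div d) = (d - e) * l + (\<Sum>x=c..<k. x div d)"
    using c by (simp flip: sum.atLeastLessThan_concat[of "k - r" c k])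
  have "t \<in> top_residues d k r" if t: "t \<in> {a..a + (d - 1)}" for t
  proof -
    \<comment> \<open>The right-hand side is \<open>(d - e) * e\<close>, and two positive factors of
      sum \<open>d\<close> have product at least \<open>d - 1\<close>.\<close>
    have "d - 1 \<le> (d - e) * (d - (d - e))"
    proof -
      obtain f where "d = e + Suc f" using assms(3) less_imp_Suc_add by auto
      moreover obtain e' where "e = Suc e'" using assms(2) by (cases e) auto
      ultimately show ?thesis by auto
    qed
    moreover have "\<Sum>{d - (d - e)..<d} = \<Sum>{..<d - e} + (d - e) * (d - (d - e))"
      by (rule sum_final_ident) simp
    ultimately have "t - (\<Sum>x=c..<k. x mod d) \<in> {\<Sum>{..<d - e}..\<Sum>{d - (d - e)..<d}}"
      using t unfolding a_def atLeastAtMost_iff by linarith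
    then obtain R where R: "R \<subseteq> {..<d}" "card R = d - e" "\<Sum>R = t - (\<Sum>x=c..<k. x mod d)"
      using subset_sum_interpolation[OF mono_ident, of "d - e" d "t - (\<Sum>x=c..<k. x mod d)"] by auto
    have fin: "finite R" using R finite_subset by auto
    define S where "S = (+) (l * d) ` R \<union> {c..<k}"
    have "(+) (l * d) ` R \<subseteq> {..<c}" using R(1) by (auto simp: c_def)
    then have disj: "(+) (l * d) ` R \<inter> {c..<k} = {}" "S \<subseteq> {..<k}" using c unfolding S_def by auto
    have "card S = card ((+) (l * d) ` R) + card {c..<k}"
      unfolding S_def by (intro card_Un_disjoint disj) (use fin in auto)
    also have "\<dots> = (d - e) + (k - c)" using R(2) by (simp add: card_image)
    also have "\<dots> = r" using c assms(3,5) by linarith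
    finally have "card S = r" .
    moreover have "(\<Sum>x\<in>S. x div d) = (\<Sum>x=k-r..<k. x div d)"
      unfolding S_def top using disj(1) fin sum_block_div_mod(1)[OF R(1) fin] R(2)
      by (subst sum.union_disjoint) simp_all
    moreover have "(\<Sum>x\<in>S. x mod d) = t"
      unfolding S_def using disj(1) fin sum_block_div_mod(2)[OF R(1) fin] R(3) t
      by (subst sum.union_disjoint) (simp_all add: a_def)
    ultimately show ?thesis using disj(2) unfolding top_residues_def
      by (intro CollectI exI[of _ S]) simp
  qed
  then show ?thesis by blast
qed

lemma card_mod_sums_interval:
  fixes a b c d :: nat
  assumes "0 < d" "a \<le> b"
  shows "card ((\<lambda>x. x mod d) ` {t + e | t e. t \<in> {a..b} \<and> e \<le> c}) = min d (b - a + c + 1)"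
proof -
  have "{t + e | t e. t \<in> {a..b} \<and> e \<le> c} = {a..b + c}"
  proof (intro equalityI subsetI)
    fix x assume "x \<in> {a..b + c}"
    then show "x \<in> {t + e | t e. t \<in> {a..b} \<and> e \<le> c}"
      using assms(2) by (intro CollectI exI[of _ "min x b"] exI[of _ "x - min x b"]) auto
  qed auto
  then show ?thesis using card_image_mod_atLeastAtMost[OF assms(1), of a "b + c"] assms by simp
qed

lemma card_mod_sums_full:
  fixes a c d :: nat
  assumes "0 < d" "{a..a + (d - 1)} \<subseteq> T"
  shows "card ((\<lambda>x. x mod d) ` {t + e | t e. t \<in> T \<and> e \<le> c}) = d"
proof (rule antisym)
  have "card ((\<lambda>x. x mod d) ` {t + e | t e. t \<in> T \<and> e \<le> c}) \<le> card {..<d}"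
    using assms(1) by (intro card_mono) auto
  then show "card ((\<lambda>x. x mod d) ` {t + e | t e. t \<in> T \<and> e \<le> c}) \<le> d" by simp
  have "d = card ((\<lambda>x. x mod d) ` {a..a + (d - 1)})"
    using card_image_mod_atLeastAtMost[OF assms(1), of a "a + (d - 1)"] assms(1) by simp
  also have "\<dots> \<le> card ((\<lambda>x. x mod d) ` {t + e | t e. t \<in> T \<and> e \<le> c})"
  proof (intro card_mono image_mono subsetI)
    show "finite ((\<lambda>x. x mod d) ` {t + e | t e. t \<in> T \<and> e \<le> c})"
      using assms(1) by (auto intro: finite_subset[OF _ finite_lessThan[of d]])
    fix x assume "x \<in> {a..a + (d - 1)}"
    then show "x \<in> {t + e | t e. t \<in> T \<and> e \<le> c}"
      using assms(2) by (intro CollectI exI[of _ x] exI[of _ 0]) auto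
  qed
  finally show "d \<le> card ((\<lambda>x. x mod d) ` {t + e | t e. t \<in> T \<and> e \<le> c})" .
qed

text \<open>The cases follow the position of the cut \<open>k - r\<close>: in the last block, at a
  block boundary, or strictly inside a complete block. Here \<open>c\<close> bounds the residue
  contributed by the free summands.\<close>

lemma card_top_level:
  assumes "0 < d" "r \<le> k" and k: "k = u * d + v" "1 \<le> v" "v \<le> d"
    and r: "r = q * d + w" "1 \<le> w" "w \<le> d"
  shows "card ((\<lambda>x. x mod d) ` {t + e | t e. t \<in> top_residues d k r \<and> e \<le> c})
    = (if r \<le> v then min d (r * (v - r) + c + 1) else if w = v then min d (c + 1) else d)"
proof -
  consider "r \<le> v" | "v < r" "w = v" | "v < r" "w \<noteq> v" by linarith
  then show ?thesis
  proof cases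
    case 1
    then show ?thesis
      unfolding top_residues_within_level[OF k(1,3) 1]
      by (subst card_mod_sums_interval[OF assms(1)]) auto
  next
    case 2
    have "k - r = u * d - q * d" using k r 2 by linarith
    then have "d dvd k - r" by (metis diff_mult_distrib dvd_triv_right)
    then have "top_residues d k r = {\<Sum>x=k-r..<k. x mod d..\<Sum>x=k-r..<k. x mod d}"
      using top_residues_full_levels assms(1,2) by auto
    then show ?thesis using 2 card_mod_sums_interval[OF assms(1) order_refl] by simp
  next
    case 3
    have "\<exists>l e. k - r = l * d + e \<and> 0 < e \<and> e < d \<and> (l + 1) * d \<le> k"
    proof (cases "w < v")
      case True
      \<comment> \<open>With \<open>q = 0\<close> one would have \<open>r = w < v\<close>. Since
        \<open>q >= 1\<close>, the block of level \<open>u - q\<close> containing the cut is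
        complete.\<close>
      have "q \<noteq> 0" using 3 r True by (cases q) auto
      have "q * d \<le> u * d"
      proof (rule ccontr)
        assume "\<not> q * d \<le> u * d"
        then have "u < q" by simp
        then have "u * d + d \<le> q * d" by (metis Suc_leI add.commute mult_Suc mult_le_mono1)
        then show False using k r assms(2) by linarith
      qed
      then have "q \<le> u" using assms(1) by simp
      then obtain p where p: "u = q + p" using le_Suc_ex by blast
      have "d \<le> q * d" using \<open>q \<noteq> 0\<close> by simp
      moreover have "k = p * d + q * d + v" using p k(1) by (simp add: algebra_simps)
      ultimately have "k - r = p * d + (v - w)" "(p + 1) * d \<le> k"
        using r(1) True unfolding add_mult_distrib mult_1 by linarith+
      then show ?thesis using True r k by (intro exI[of _ p] exI[of _ "v - w"]) auto
    next
      case False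
      then have "v < w" using 3 by simp
      \<comment> \<open>Here the subtraction \<open>k - r\<close> borrows, so the cut lies in block
        \<open>u - q - 1\<close> at offset \<open>d + v - w\<close>.\<close>
      have "q < u"
      proof (rule ccontr)
        assume "\<not> q < u"
        then have "u * d \<le> q * d" by simp
        then show False using k r assms(2) \<open>v < w\<close> by linarith
      qed
      then obtain p where p: "u = q + Suc p" using less_imp_Suc_add by auto
      have "k = p * d + d + q * d + v" using p k(1) by (simp add: algebra_simps)
      then have "k - r = p * d + (d + v - w)" "(p + 1) * d \<le> k"
        using r(1,3) \<open>v < w\<close> unfolding add_mult_distrib mult_1 by linarith+
      then show ?thesis using \<open>v < w\<close> r k by (intro exI[of _ p] exI[of _ "d + v - w"]) auto
    qed
    then obtain l e where "k - r = l * d + e" "0 < e" "e < d" "(l + 1) * d \<le> k" by blast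
    then obtain a where "{a..a + (d - 1)} \<subseteq> top_residues d k r"
      using top_residues_split_level assms(2) by blast
    then show ?thesis using card_mod_sums_full[OF assms(1)] 3 by simp
  qed
qed

section \<open>Counting\<close>

text \<open>Each level below \<open>q\<close> occurs \<open>d\<close> times and level
  \<open>q\<close> occurs \<open>w\<close> times; doubling avoids dividing
  \<open>q * (q - 1)\<close>. Allowing \<open>w = d\<close> admits positive remainders.\<close>

lemma two_sum_div:
  assumes "0 < d" "w \<le> d"
  shows "2 * int (\<Sum>x<q * d + w. x div d) = int d * int q * (int q - 1) + 2 * int w * int q"
proof -
  have block: "(\<Sum>x<q * d + w. x div d) = (\<Sum>x<q * d. x div d) + w * q" if "w \<le> d" for q w
  proof -
    have "(\<Sum>x=q * d..<q * d + w. x div d) = w * q"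
      using sum_shift_by[of "\<lambda>x. x div d" "q * d" w] that assms(1) by simp
    then show ?thesis
      using sum.atLeastLessThan_concat[of 0 "q * d" "q * d + w" "\<lambda>x. x div d"]
      by (simp add: lessThan_atLeast0)
  qed
  have "2 * int (\<Sum>x<q * d. x div d) = int d * int q * (int q - 1)"
  proof (induction q)
    case (Suc q)
    have "(\<Sum>x<Suc q * d. x div d) = (\<Sum>x<q * d. x div d) + d * q"
      using block[of d q] by (simp add: add.commute)
    then show ?case using Suc.IH by (simp add: algebra_simps)
  qed simp
  then show ?thesis using block[OF assms(2), of q] by (simp add: algebra_simps)
qed

text \<open>The map \<open>f\<close> from indices to elements is injective, so subsets and lists of
  elements correspond to subsets and lists of indices. A sum becomes total level plus
  \<open>n\<close> times total residue.\<close>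

lemma sumset_ge_A_d_eq_image:
  assumes "0 < d" "0 < k" "k \<le> n * d" "r \<le> h"
  shows "sumset_ge (integer_mod_group (n * d)) h r (A_d d (n * d) k)
    = int ` (\<lambda>(i, j). (i + j * n) mod (n * d)) ` level_pairs d k r (h - r)"
proof -
  define f where "f = (\<lambda>x. int (x div d + x mod d * n))"
  have n: "0 < n" using assms by (cases n) auto
  have lt: "x div d < n" if "x < k" for x
    using that assms by (metis div_less_iff_less_mult less_le_trans)
  have inj: "inj_on f {..<k}"
  proof (rule inj_onI)
    fix x y assume "x \<in> {..<k}" "y \<in> {..<k}" "f x = f y"
    then have eq: "x div d + x mod d * n = y div d + y mod d * n" by (simp only: f_def of_nat_eq_iff)
    then have "(x div d + x mod d * n) mod n = (y div d + y mod d * n) mod n" by (rule arg_cong)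
    then have "x div d = y div d" using lt \<open>x \<in> _\<close> \<open>y \<in> _\<close> by simp
    moreover from this have "x mod d = y mod d" using eq n by simp
    ultimately show "x = y" by (metis div_mult_mod_eq)
  qed
  have A: "A_d d (n * d) k = f ` {..<k}" using A_d_eq_image[OF assms(1-3)] by (simp add: f_def)
  have "f x < int (n * d)" if "x < k" for x
  proof -
    have "x mod d + 1 \<le> d" using assms(1) by (simp add: Suc_leI)
    then have "(x mod d + 1) * n \<le> d * n" by (rule mult_le_mono1)
    then have "x div d + x mod d * n < n * d" using lt[OF that] by (simp add: algebra_simps)
    then show ?thesis unfolding f_def by (rule of_nat_less_iff[THEN iffD2])
  qed
  moreover have "0 \<le> f x" for x by (simp add: f_def)
  ultimately have sub: "f ` {..<k} \<subseteq> carrier (integer_mod_group (n * d))"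
    using n assms(1) by (auto simp: carrier_integer_mod_group)
  have val: "(\<Sum>(f ` R) + sum_list (map f xs)) mod int (n * d) =
      int ((\<lambda>(i, j). (i + j * n) mod (n * d))
        ((\<Sum>x\<in>R. x div d) + (\<Sum>x\<leftarrow>xs. x div d), ((\<Sum>x\<in>R. x mod d) + (\<Sum>x\<leftarrow>xs. x mod d)) mod d))"
    if "R \<subseteq> {..<k}" for R xs
  proof -
    define I J where "I = (\<Sum>x\<in>R. x div d) + (\<Sum>x\<leftarrow>xs. x div d)"
      and "J = (\<Sum>x\<in>R. x mod d) + (\<Sum>x\<leftarrow>xs. x mod d)"
    have "sum_list (map f xs) = int ((\<Sum>x\<leftarrow>xs. x div d) + (\<Sum>x\<leftarrow>xs. x mod d) * n)"
      by (induction xs) (auto simp: f_def algebra_simps)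
    moreover have "\<Sum>(f ` R) = int ((\<Sum>x\<in>R. x div d) + (\<Sum>x\<in>R. x mod d) * n)"
      using inj_on_subset[OF inj that]
      by (simp add: sum.reindex f_def sum.distrib sum_distrib_right)
    ultimately have "\<Sum>(f ` R) + sum_list (map f xs) = int (I + J * n)"
      by (simp add: I_def J_def algebra_simps)
    moreover have "(J mod d * n) mod (n * d) = (J * n) mod (n * d)"
      by (simp add: mult.commute[of _ n] flip: mult_mod_right)
    then have "(I + J mod d * n) mod (n * d) = (I + J * n) mod (n * d)" by (metis mod_add_right_eq)
    ultimately show ?thesis unfolding I_def[symmetric] J_def[symmetric] by (simp add: of_nat_mod)
  qed
  have "sumset_ge (integer_mod_group (n * d)) h r (A_d d (n * d) k)
    = {(\<Sum>R + sum_list xs) mod int (n * d) | R xs.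
       R \<subseteq> f ` {..<k} \<and> card R = r \<and> length xs = h - r \<and> set xs \<subseteq> f ` {..<k}}"
    unfolding A by (rule sumset_ge_integer_mod_group[OF sub _ assms(4)]) simp
  also have "\<dots> = {(\<Sum>(f ` R) + sum_list (map f xs)) mod int (n * d) | R xs.
       R \<subseteq> {..<k} \<and> card R = r \<and> length xs = h - r \<and> set xs \<subseteq> {..<k}}" (is "?L = ?S")
  proof (intro equalityI subsetI)
    fix z assume "z \<in> ?L"
    then obtain R xs where *: "R \<subseteq> f ` {..<k}" "card R = r" "length xs = h - r" "set xs \<subseteq> f ` {..<k}"
      and z: "z = (\<Sum>R + sum_list xs) mod int (n * d)" by blast
    obtain R' where R': "R' \<subseteq> {..<k}" "inj_on f R'" "R = f ` R'" using *(1) subset_image_inj by metis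
    have "xs \<in> map f ` lists {..<k}" using *(4) unfolding lists_image[symmetric] by (simp add: in_lists_conv_set subset_iff)
    then obtain xs' where xs': "xs = map f xs'" "set xs' \<subseteq> {..<k}" by (auto simp: in_lists_conv_set)
    show "z \<in> ?S" using * R' xs' z
      by (intro CollectI exI[of _ R'] exI[of _ xs']) (auto simp: card_image)
  next
    fix z assume "z \<in> ?S"
    then obtain R xs where *: "R \<subseteq> {..<k}" "card R = r" "length xs = h - r" "set xs \<subseteq> {..<k}"
      and z: "z = (\<Sum>(f ` R) + sum_list (map f xs)) mod int (n * d)" by blast
    then have "card (f ` R) = r" using card_image[OF inj_on_subset[OF inj *(1)]] by simp
    then show "z \<in> ?L" using * z
      by (intro CollectI exI[of _ "f ` R"] exI[of _ "map f xs"]) auto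
  qed
  also have "\<dots> = int ` (\<lambda>(i, j). (i + j * n) mod (n * d)) ` level_pairs d k r (h - r)" (is "_ = ?T")
  proof (intro equalityI subsetI)
    fix z assume "z \<in> ?S"
    then obtain R xs where *: "R \<subseteq> {..<k}" "card R = r" "length xs = h - r" "set xs \<subseteq> {..<k}"
      and z: "z = (\<Sum>(f ` R) + sum_list (map f xs)) mod int (n * d)" by blast
    show "z \<in> ?T" unfolding z val[OF *(1)] level_pairs_def using * by (intro imageI CollectI exI conjI) auto
  next
    fix z assume "z \<in> ?T"
    then obtain R xs where *: "R \<subseteq> {..<k}" "card R = r" "length xs = h - r" "set xs \<subseteq> {..<k}"
      and z: "z = int ((\<lambda>(i, j). (i + j * n) mod (n * d))
        ((\<Sum>x\<in>R. x div d) + (\<Sum>x\<leftarrow>xs. x div d), ((\<Sum>x\<in>R. x mod d) + (\<Sum>x\<leftarrow>xs. x mod d)) mod d))"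
      unfolding level_pairs_def by blast
    show "z \<in> ?S" unfolding z val[OF *(1), symmetric] using * by blast
  qed
  finally show ?thesis .
qed

text \<open>The coefficient of \<open>d\<close> is the number of complete levels, that is, maximal
  minus minimal total level; the last summand is the size of the top level.\<close>

lemma card_sumset_ge_A_d:
  assumes "0 < d" "0 < n" "k \<le> n * d" "r \<le> k" "r < h"
    and k: "k = u * d + v" "1 \<le> v" "v \<le> d" and r: "r = q * d + w" "1 \<le> w" "w \<le> d"
  shows "int (card (sumset_ge (integer_mod_group (n * d)) h r (A_d d (n * d) k))) =
    min (int (n * d))
     ((int d * int q * (int u - int q) + int v * int q + int w * int u - 2 * int w * int q
        + (int h - int r) * int u - max 0 (int w - int v)) * int d
      + (if r \<le> v then min (int d) (int r * (int v - int r) + (int h - int r) * (int v - 1) + 1)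
         else if w = v then min (int d) ((int h - int r) * (int v - 1) + 1) else int d))"
proof -
  define lo where "lo = (\<Sum>x<r. x div d)"
  define top where "top = (\<Sum>x=k-r..<k. x div d)"
  define s where "s = h - r"
  define P where "P = (\<lambda>x. x mod d) ` {t + e | t e. t \<in> top_residues d k r \<and> e \<le> s * (v - 1)}"
  have s: "0 < s" "int s = int h - int r" using assms by (auto simp: s_def)
  have k0: "0 < k" using k by simp
  have lo_top: "lo \<le> top"
    using sum_initial_le_sum[OF mono_div, of "{k-r..<k}" r d] assms(4) unfolding lo_def top_def by simp
  have cardP: "card P = (if r \<le> v then min d (r * (v - r) + s * (v - 1) + 1)
      else if w = v then min d (s * (v - 1) + 1) else d)"
    unfolding P_def by (rule card_top_level[OF assms(1,4) k r])
  then have "card P \<noteq> 0" using assms(1) by (auto split: if_splits)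
  then have "P \<noteq> {}" by auto
  moreover have "P \<subseteq> {..<d}" using assms(1) by (auto simp: P_def)
  moreover have "level_pairs d k r s = {lo..<top + s * u} \<times> {..<d} \<union> {top + s * u} \<times> P"
    unfolding lo_def top_def P_def by (rule level_pairs_eq[OF assms(1,4) s(1) k])
  ultimately have "card ((\<lambda>(i, j). (i + j * n) mod (n * d)) ` level_pairs d k r s)
      = min (n * d) ((top + s * u - lo) * d + card P)"
    using card_image_two_digit_mod[OF assms(2,1), of lo "top + s * u" P] lo_top by simp
  then have card: "card (sumset_ge (integer_mod_group (n * d)) h r (A_d d (n * d) k))
      = min (n * d) ((top + s * u - lo) * d + card P)"
    using sumset_ge_A_d_eq_image[OF assms(1) k0 assms(3), of r h] assms(5)
    by (simp add: s_def card_image)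
  have "(\<Sum>x<k. x div d) = (\<Sum>x<k - r. x div d) + top"
    using sum.atLeastLessThan_concat[of 0 "k - r" k "\<lambda>x. x div d"]
    unfolding top_def by (simp add: lessThan_atLeast0)
  then have F: "2 * int top = 2 * int (\<Sum>x<k. x div d) - 2 * int (\<Sum>x<k - r. x div d)" by simp
  have Fk: "2 * int (\<Sum>x<k. x div d) = int d * int u * (int u - 1) + 2 * int v * int u"
    using two_sum_div[OF assms(1) k(3), of u] k(1) by simp
  have Fr: "2 * int lo = int d * int q * (int q - 1) + 2 * int w * int q"
    using two_sum_div[OF assms(1) r(3), of q] r(1) unfolding lo_def by simp
  \<comment> \<open>For \<open>w > v\<close> the division of \<open>k - r\<close> by
    \<open>d\<close> borrows one block; the \<open>max\<close> term is the resulting correction to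
    the formula without borrowing.\<close>
  have Fkr: "2 * int (\<Sum>x<k - r. x div d) =
      int d * (int u - int q) * (int u - int q - 1) + 2 * (int v - int w) * (int u - int q)
        + 2 * max 0 (int w - int v)"
  proof (cases "w \<le> v")
    case True
    have "q \<le> u"
    proof (rule ccontr)
      assume "\<not> q \<le> u"
      then have "Suc u * d \<le> q * d" by (intro mult_le_mono1) simp
      then show False using k r assms(4) by simp
    qed
    then obtain p where p: "u = q + p" using le_Suc_ex by blast
    have "k - r = p * d + (v - w)" using p k(1) r(1) True by (simp add: algebra_simps)
    moreover have "v - w \<le> d" using k by simp
    ultimately show ?thesis using two_sum_div[OF assms(1), of "v - w" p] True p by simp
  next
    case False
    have "q < u"
    proof (rule ccontr)
      assume "\<not> q < u"
      then have "u * d \<le> q * d" by simp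
      then show False using k r assms(4) False by linarith
    qed
    then obtain p where p: "u = q + Suc p" using less_imp_Suc_add by auto
    have "k = p * d + d + q * d + v" using p k(1) by (simp add: algebra_simps)
    then have "k - r = p * d + (d + v - w)" using r(1,3) by linarith
    moreover have "d + v - w \<le> d" "int (d + v - w) = int d + int v - int w" using False r by auto
    ultimately show ?thesis using two_sum_div[OF assms(1), of "d + v - w" p] False p
      by (simp add: algebra_simps)
  qed
  have "2 * int (top + s * u - lo) = 2 * int top + 2 * int s * int u - 2 * int lo"
    using lo_top by simp
  also have "\<dots> = 2 * (int d * int q * (int u - int q) + int v * int q + int w * int u - 2 * int w * int q
        + (int h - int r) * int u - max 0 (int w - int v))"
    unfolding F Fk Fr Fkr s(2) by (simp add: algebra_simps)
  finally have L: "int (top + s * u - lo) =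
    int d * int q * (int u - int q) + int v * int q + int w * int u - 2 * int w * int q
        + (int h - int r) * int u - max 0 (int w - int v)" by simp
  have vi: "int (v - 1) = int v - 1" using k by simp
  have "int (card P) = (if r \<le> v then min (int d) (int r * (int v - int r) + (int h - int r) * (int v - 1) + 1)
      else if w = v then min (int d) ((int h - int r) * (int v - 1) + 1) else int d)"
  proof -
    have 1: "int (s * (v - 1) + 1) = (int h - int r) * (int v - 1) + 1"
      unfolding of_nat_add of_nat_mult vi s(2) by simp
    have "int (r * (v - r) + s * (v - 1) + 1) = int r * (int v - int r) + (int h - int r) * (int v - 1) + 1"
      if "r \<le> v"
      unfolding of_nat_add of_nat_mult vi s(2) using that by simp
    then show ?thesis unfolding cardP by (auto simp only: of_nat_min 1 split: if_split)
  qed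
  then show ?thesis unfolding card of_nat_min of_nat_add of_nat_mult L by simp
qed

section \<open>Comparison with the closed formula\<close>

lemma positive_remainder_eq:
  assumes "0 < r" "1 \<le> w" "w \<le> d" "[w = r] (mod d)"
  shows "r = ((r - 1) div d) * d + (w::nat)"
proof -
  have "[w - 1 = r - 1] (mod d)"
    using assms cong_add_rcancel_nat[of "w - 1" 1 "r - 1" d] by simp
  moreover have "w - 1 < d" using assms by linarith
  ultimately have "(r - 1) mod d = w - 1" by (simp add: cong_def)
  then have "r - 1 = ((r - 1) div d) * d + (w - 1)" by (metis div_mult_mod_eq)
  then show ?thesis using assms by linarith
qed

theorem theorem4p1:
  fixes m k r d v w :: nat
  assumes "0 < m" and "0 < k" and "0 < r" and "0 < d"
    and "r \<le> k" and "k \<le> m" and "d dvd m"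
    and "1 \<le> v" and "v \<le> d" and "[v = k] (mod d)"
    and "1 \<le> w" and "w \<le> d" and "[w = r] (mod d)"
  shows "\<forall>h :: nat. r < h \<longrightarrow>
    int (card (sumset_ge (integer_mod_group m) h r (A_d d m k))) =
      (if r \<le> min v (d - 1) then
         Min {int m,
              (int h * \<lceil>real k / real d\<rceil> - int h + 1) * int d,
              int h * (int k - 1) - int r * (int r - 1) + 1}
       else
         min (int m)
             (int h * (int k - 1) - int r * (int r - 1) + 1
                - (if v = w then max 0 (delta_d d h r v w) else delta_d d h r v w)))"
proof (intro allI impI)
  fix h assume "r < h"
  obtain n where m: "m = n * d" using assms(7) by (metis dvd_def mult.commute)
  have n: "0 < n" "k \<le> n * d" using assms m by auto
  define u q where "u = (k - 1) div d" and "q = (r - 1) div d"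
  have k: "k = u * d + v" and r: "r = q * d + w"
    using positive_remainder_eq assms unfolding u_def q_def by auto
  define s where "s = int h - int r"
  have h: "int h = s + int r" by (simp add: s_def)
  define L where "L = int d * int q * (int u - int q) + int v * int q + int w * int u - 2 * int w * int q
        + s * int u - max 0 (int w - int v)"
  define p where "p = (if r \<le> v then min (int d) (int r * (int v - int r) + s * (int v - 1) + 1)
         else if w = v then min (int d) (s * (int v - 1) + 1) else int d)"
  have card: "int (card (sumset_ge (integer_mod_group m) h r (A_d d m k))) = min (int m) (L * int d + p)"
    using card_sumset_ge_A_d[OF assms(4) n assms(5) \<open>r < h\<close> k assms(8,9) r assms(11,12)]
    unfolding L_def p_def s_def m .
  \<comment> \<open>The terms in \<open>w\<close> alone combine to \<open>w * (v - w)\<close> for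
    \<open>w <= v\<close> and to \<open>(d - w) * (w - v)\<close> for \<open>v < w\<close>, the
    middle terms of \<open>delta_d\<close>.\<close>
  have Ld: "int h * (int k - 1) - int r * (int r - 1) + 1 =
      L * int d + s * (int v - 1) + int w * (int v - int w) + 1 + int d * max 0 (int w - int v)"
    unfolding h L_def k r by (simp add: algebra_simps)
  show "int (card (sumset_ge (integer_mod_group m) h r (A_d d m k))) =
      (if r \<le> min v (d - 1) then
         Min {int m,
              (int h * \<lceil>real k / real d\<rceil> - int h + 1) * int d,
              int h * (int k - 1) - int r * (int r - 1) + 1}
       else
         min (int m)
             (int h * (int k - 1) - int r * (int r - 1) + 1
                - (if v = w then max 0 (delta_d d h r v w) else delta_d d h r v w)))"
  proof (cases "r \<le> min v (d - 1)")
    case True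
    then have rv: "r \<le> v" by simp
    have "r - 1 < d" using True assms(4) by linarith
    then have "q = 0" by (simp add: q_def)
    with r have q: "q = 0" "w = r" by auto
    have "\<lceil>real k / real d\<rceil> = int u + 1"
    proof (rule ceiling_unique)
      show "real_of_int (int u + 1) - 1 < real k / real d"
        using assms(4,8) by (simp add: k field_simps)
      show "real k / real d \<le> real_of_int (int u + 1)"
        using assms(4,9) by (simp add: k field_simps)
    qed
    \<comment> \<open>With \<open>q = 0\<close> the number of complete levels is
      \<open>L = h * u\<close>. The second entry of the minimum is thus the count with a full top
      coset, and the third the count with a partial one.\<close>
    then have "(int h * \<lceil>real k / real d\<rceil> - int h + 1) * int d = L * int d + int d"
      using q rv unfolding L_def h by (simp add: algebra_simps)
    moreover have "p = min (int d) (int r * (int v - int r) + s * (int v - 1) + 1)"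
      using rv by (simp add: p_def)
    moreover have "int h * (int k - 1) - int r * (int r - 1) + 1
        = L * int d + (int r * (int v - int r) + s * (int v - 1) + 1)"
      unfolding Ld using q rv by simp
    ultimately show ?thesis using True unfolding card by (simp add: min_add_distrib_right)
  next
    case False
    show ?thesis
    proof (cases "v = w")
      case True
      have "p = min (int d) (s * (int v - 1) + 1)"
      proof (cases "r \<le> v")
        case True
        \<comment> \<open>Then \<open>r * (v - r)\<close> vanishes and the two formulas for
          \<open>p\<close> agree.\<close>
        then have "r = v" using \<open>v = w\<close> r by simp
        then show ?thesis by (simp add: p_def)
      qed (use True in \<open>simp add: p_def\<close>)
      moreover have "delta_d d h r v w = s * (int v - 1) - (int d - 1)"
        using True by (simp add: delta_d_def s_def)
      \<comment> \<open>Subtracting \<open>max 0\<close> of the excess of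
        \<open>s * (v - 1) + 1\<close> over \<open>d\<close> is the same as taking the minimum with
        \<open>d\<close> in \<open>p\<close>.\<close>
      ultimately have "int h * (int k - 1) - int r * (int r - 1) + 1 - max 0 (delta_d d h r v w) = L * int d + p"
        unfolding Ld using True by simp
      then show ?thesis unfolding card if_not_P[OF False] using True by simp
    next
      case neq: False
      have "\<not> r \<le> v"
      proof
        assume "r \<le> v"
        then have "r = d" "v = d" using False assms(9) by auto
        then have "w = d" using r assms(4,11,12) by (cases q) auto
        then show False using neq \<open>v = d\<close> by simp
      qed
      then have p: "p = int d" using neq by (simp add: p_def)
      \<comment> \<open>For \<open>v < w = d\<close> the factor \<open>d - w\<close> is zero, so the
        last branch of \<open>delta_d\<close> fits the same identity.\<close>
      have "int h * (int k - 1) - int r * (int r - 1) + 1 - delta_d d h r v w = L * int d + p"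
        unfolding Ld p delta_d_def s_def using neq assms(12) by (auto simp: algebra_simps)
      then show ?thesis unfolding card if_not_P[OF False] using neq by simp
    qed
  qed
qed

end
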